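(* Let $V=(V,+,\circ,K)$ be a hypervector space over a field $K$, and let $(F,A)$ and $(G,B)$ be bipolar fuzzy soft hypervector spaces of $V$. Then the extended sum $(F,A)+_\varepsilon(G,B)$ is a bipolar fuzzy soft hypervector space of $V$.
   Context: Hypervector space: let $K$ be a field, $(V,+)$ an Abelian group, $P_*(V)$ the set of non-empty subsets of $V$. A hypervector space over $K$ is a quadruple $(V,+,\circ,K)$ with an external hyperoperation $\circ:K\times V\to P_*(V)$ such that for all $a,b\in K$, $x,y\in V$: (i) $a\circ(x+y)\subseteq a\circ x+a\circ y$; (ii) $(a+b)\circ x\subseteq a\circ x+b\circ x$; (iii) $a\circ(b\circ x)=(ab)\circ x$; (iv) $a\circ(-x)=(-a)\circ x=-(a\circ x)$; (v) $x\in 1\circ x$. Here, for subsets, $S+T=\{p+q: p\in S,q\in T\}$, $-S=\{-s:s\in S\}$, and $a\circ(b\circ x)=\bigcup_{t\in b\circ x}a\circ t$. Bipolar fuzzy soft set: let $E$ be a set of parameters and $A\subseteq E$. A bipolar fuzzy soft set $(F,A)$ over $V$ assigns to each $e\in A$ a pair of functions $F_e^+:V\to[0,1]$ and $F_e^-:V\to[-1,0]$. The parameter sets $A,B$ are subsets of a common $E$. Bipolar fuzzy soft hypervector space: $(F,A)$ is a bipolar fuzzy soft hypervector space of $V$ if for all $e\in A$, $x,y\in V$, $a\in K$: (1) $F_e^+(x-y)\ge F_e^+(x)\wedge F_e^+(y)$ and $F_e^-(x-y)\le F_e^-(x)\vee F_e^-(y)$; (2) $\bigwedge_{t\in a\circ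 x}F_e^+(t)\ge F_e^+(x)$ and $\bigvee_{t\in a\circ x}F_e^-(t)\le F_e^-(x)$. Here $\wedge,\vee$ (and $\bigwedge,\bigvee$) denote minimum and maximum (infimum and supremum) of real numbers. Extended sum: $(F,A)+_\varepsilon(G,B)$ is the bipolar fuzzy soft set $(F+_\varepsilon G,A\cup B)$ where, for $x\in V$ and each sign $\pm$, $(F+_\varepsilon G)^\pm_e(x)=F^\pm_e(x)$ if $e\in A\setminus B$; $(F+_\varepsilon G)^\pm_e(x)=G^\pm_e(x)$ if $e\in B\setminus A$; and if $e\in A\cap B$, then $(F+_\varepsilon G)^\pm_e(x)=(F+G)^\pm_e(x)$, where $$(F+G)^+_e(x)=\bigvee_{x=y+z}\bigl(F^+_e(y)\wedge G^+_e(z)\bigr),\qquad (F+G)^-_e(x)=\bigwedge_{x=y+z}\bigl(F^-_e(y)\vee G^-_e(z)\bigr),$$ the supremum and infimum being over all $(y,z)\in V\times V$ with $x=y+z$. *)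

theory Defs
  imports Complex_Main "HOL-Library.Set_Algebras"
begin

text \<open>
  The abelian group and the field are given by types. The sum of two subsets is the
  elementwise sum of \<^theory>\<open>HOL-Library.Set_Algebras\<close>; the negative of a subset is its
  image under \<^const>\<open>uminus\<close>. The axiom \<open>hop_nonempty\<close> says that the values of the external
  hyperoperation are non-empty subsets.
\<close>

locale hypervector_space =
  fixes hop :: "'k::field \<Rightarrow> 'v::ab_group_add \<Rightarrow> 'v set"
  assumes hop_nonempty: "hop a x \<noteq> {}"
    and hop_add_right: "hop a (x + y) \<subseteq> hop a x + hop a y"
    and hop_add_left: "hop (a + b) x \<subseteq> hop a x + hop b x"
    and hop_assoc: "(\<Union>t\<in>hop b x. hop a t) = hop (a * b) x"
    and hop_minus_right: "hop a (- x) = hop (- a) x"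
    and hop_minus_left: "hop (- a) x = uminus ` hop a x"
    and hop_one: "x \<in> hop 1 x"

text \<open>
  A bipolar fuzzy set is a pair of membership functions (positive, negative), and a soft set
  \<open>(F, A)\<close> pairs the assignment \<open>F\<close> with its parameter set. As \<open>F\<close> is a total function,
  its values outside \<open>A\<close> are irrelevant.
\<close>

type_synonym 'v bipolar_fuzzy_set = "('v \<Rightarrow> real) \<times> ('v \<Rightarrow> real)"

type_synonym ('e, 'v) soft_set = "('e \<Rightarrow> 'v bipolar_fuzzy_set) \<times> 'e set"

abbreviation pos :: "'v bipolar_fuzzy_set \<Rightarrow> 'v \<Rightarrow> real"
  where "pos \<equiv> fst"

abbreviation neg :: "'v bipolar_fuzzy_set \<Rightarrow> 'v \<Rightarrow> real"
  where "neg \<equiv> snd"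

definition bipolar_fuzzy_soft_set :: "'e set \<Rightarrow> ('e, 'v) soft_set \<Rightarrow> bool"
  where "bipolar_fuzzy_soft_set E = (\<lambda>(F, A). A \<subseteq> E \<and>
    (\<forall>e\<in>A. \<forall>x. pos (F e) x \<in> {0..1} \<and> neg (F e) x \<in> {-1..0}))"

text \<open>
  The range conditions on the membership functions and the non-emptiness of \<open>hop a x\<close> make
  all the real infima and suprema below range over non-empty bounded sets.
\<close>

definition bipolar_fuzzy_soft_hypervector_space ::
    "('k::field \<Rightarrow> 'v::ab_group_add \<Rightarrow> 'v set) \<Rightarrow> 'e set \<Rightarrow> ('e, 'v) soft_set \<Rightarrow> bool"
  where "bipolar_fuzzy_soft_hypervector_space hop E = (\<lambda>(F, A).
    bipolar_fuzzy_soft_set E (F, A) \<and>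
    (\<forall>e\<in>A. \<forall>x y a.
      pos (F e) (x - y) \<ge> min (pos (F e) x) (pos (F e) y) \<and>
      neg (F e) (x - y) \<le> max (neg (F e) x) (neg (F e) y) \<and>
      (INF t\<in>hop a x. pos (F e) t) \<ge> pos (F e) x \<and>
      (SUP t\<in>hop a x. neg (F e) t) \<le> neg (F e) x))"

definition bipolar_fuzzy_sum ::
    "'v::ab_group_add bipolar_fuzzy_set \<Rightarrow> 'v bipolar_fuzzy_set \<Rightarrow> 'v bipolar_fuzzy_set"
  where "bipolar_fuzzy_sum f g =
    (\<lambda>x. SUP (y, z)\<in>{(y, z). x = y + z}. min (pos f y) (pos g z),
     \<lambda>x. INF (y, z)\<in>{(y, z). x = y + z}. max (neg f y) (neg g z))"

definition extended_sum ::
    "('e, 'v::ab_group_add) soft_set \<Rightarrow> ('e, 'v) soft_set \<Rightarrow> ('e, 'v) soft_set"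
  where "extended_sum = (\<lambda>(F, A) (G, B).
    (\<lambda>e. if e \<in> A - B then F e
         else if e \<in> B - A then G e
         else if e \<in> A \<inter> B then bipolar_fuzzy_sum (F e) (G e)
         else undefined,
     A \<union> B))"

end

theory Submission
  imports Defs
begin

text \<open>
  Negating the negative membership function turns its conditions into those of the positive one,
  so only one fuzzy membership function with values in \<open>[0, 1]\<close> has to be treated. There, a
  decomposition of \<open>x\<close> and one of \<open>x'\<close> yield one of \<open>x - x'\<close>, and since
  \<open>a \<circ> (y + z) \<subseteq> a \<circ> y + a \<circ> z\<close>, a decomposition of \<open>x\<close> yields one of each \<open>t \<in> a \<circ> x\<close>;
  in both cases the memberships of the parts do not decrease.
\<close>

text \<open>Closure under \<open>hop\<close> is stated pointwise, so that a bound at a given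
  \<open>t\<close> is available directly; \<open>bipolar_fuzzy_soft_hypervector_space_iff\<close>
  translates it to infima and suprema.\<close>

definition fuzzy_hypersubspace :: "('k \<Rightarrow> 'v::ab_group_add \<Rightarrow> 'v set) \<Rightarrow> ('v \<Rightarrow> real) \<Rightarrow> bool"
  where "fuzzy_hypersubspace hop f \<longleftrightarrow>
    (\<forall>x. f x \<in> {0..1}) \<and>
    (\<forall>x y. min (f x) (f y) \<le> f (x - y)) \<and>
    (\<forall>a x. \<forall>t\<in>hop a x. f x \<le> f t)"

text \<open>The sup-min convolution. With \<open>x - y\<close> as second part, the supremum ranges
  over a whole type rather than a set of pairs.\<close>

definition fuzzy_sum :: "('v::ab_group_add \<Rightarrow> real) \<Rightarrow> ('v \<Rightarrow> real) \<Rightarrow> 'v \<Rightarrow> real"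
  where "fuzzy_sum f g x = (SUP y. min (f y) (g (x - y)))"

lemma fuzzy_sum_upper:
  assumes "\<And>y. f y \<le> b"
  shows "min (f y) (g z) \<le> fuzzy_sum f g (y + z)"
proof -
  have "bdd_above (range (\<lambda>u. min (f u) (g (y + z - u))))"
    using assms by (intro bdd_aboveI2[where M = b]) (simp add: min.coboundedI1)
  then have "min (f y) (g (y + z - y)) \<le> fuzzy_sum f g (y + z)"
    unfolding fuzzy_sum_def by (rule cSUP_upper2[where x = y]) auto
  then show ?thesis by simp
qed

lemma fuzzy_sum_least:
  assumes "\<And>y z. x = y + z \<Longrightarrow> min (f y) (g z) \<le> c"
  shows "fuzzy_sum f g x \<le> c"
  unfolding fuzzy_sum_def by (rule cSUP_least) (auto intro: assms)

text \<open>The supremum need not be attained, but a value strictly below it is exceeded by some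
  decomposition.\<close>

lemma less_fuzzy_sumD:
  assumes "c < fuzzy_sum f g x"
  obtains y z where "x = y + z" "c < f y" "c < g z"
  using assms fuzzy_sum_least[of x f g c] by (metis min_less_iff_conj not_le)

lemma fuzzy_hypersubspace_fuzzy_sum:
  assumes hop: "hypervector_space hop"
    and f: "fuzzy_hypersubspace hop f" and g: "fuzzy_hypersubspace hop g"
  shows "fuzzy_hypersubspace hop (fuzzy_sum f g)"
proof -
  have f01: "0 \<le> f x" "f x \<le> 1" and g01: "0 \<le> g x" for x
    using f g by (auto simp: fuzzy_hypersubspace_def)
  have "fuzzy_sum f g x \<in> {0..1}" for x
  proof -
    \<comment> \<open>The trivial decomposition \<open>x = x + 0\<close> gives the lower
      bound.\<close>
    have "0 \<le> min (f x) (g 0)" using f01 g01 by simp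
    also have "\<dots> \<le> fuzzy_sum f g x" using fuzzy_sum_upper[OF f01(2), where y = x and z = 0] by simp
    finally show ?thesis
      using f01 by (auto intro!: fuzzy_sum_least simp: min.coboundedI1)
  qed
  moreover have "min (fuzzy_sum f g x) (fuzzy_sum f g x') \<le> fuzzy_sum f g (x - x')" for x x'
  \<comment> \<open>Testing against every \<open>c\<close> strictly below both suprema supplies
    decompositions of \<open>x\<close> and \<open>x'\<close> to subtract componentwise.\<close>
  proof (rule dense_le)
    fix c assume "c < min (fuzzy_sum f g x) (fuzzy_sum f g x')"
    then have "c < fuzzy_sum f g x" "c < fuzzy_sum f g x'" by simp_all
    then obtain y z y' z' where x: "x = y + z" "c < f y" "c < g z"
      and x': "x' = y' + z'" "c < f y'" "c < g z'"
      by (elim less_fuzzy_sumD)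
    have "c \<le> min (min (f y) (f y')) (min (g z) (g z'))" using x x' by simp
    also have "\<dots> \<le> min (f (y - y')) (g (z - z'))"
      using f g by (intro min.mono) (auto simp: fuzzy_hypersubspace_def)
    also have "\<dots> \<le> fuzzy_sum f g (x - x')"
      using fuzzy_sum_upper[OF f01(2), where y = "y - y'" and z = "z - z'"] x x' by (simp add: algebra_simps)
    finally show "c \<le> fuzzy_sum f g (x - x')" .
  qed
  moreover have "fuzzy_sum f g x \<le> fuzzy_sum f g t" if "t \<in> hop a x" for a x t
  \<comment> \<open>With a single supremum on the left, its terms can be bounded one by one.\<close>
  proof (rule fuzzy_sum_least)
    fix y z assume "x = y + z"
    with that hop obtain p q where t: "t = p + q" "p \<in> hop a y" "q \<in> hop a z"
      by (blast dest: hypervector_space.hop_add_right elim: set_plus_elim)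
    then have "min (f y) (g z) \<le> min (f p) (g q)"
      using f g by (intro min.mono) (auto simp: fuzzy_hypersubspace_def)
    also have "\<dots> \<le> fuzzy_sum f g t" using fuzzy_sum_upper[OF f01(2)] t(1) by simp
    finally show "min (f y) (g z) \<le> fuzzy_sum f g t" .
  qed
  ultimately show ?thesis by (simp add: fuzzy_hypersubspace_def)
qed

text \<open>Each \<open>hop a x\<close> is non-empty and the memberships are bounded, so bounds on
  the real infima and suprema amount to pointwise bounds.\<close>

lemma bipolar_fuzzy_soft_hypervector_space_iff:
  assumes "hypervector_space hop"
  shows "bipolar_fuzzy_soft_hypervector_space hop E (F, A) \<longleftrightarrow>
    A \<subseteq> E \<and> (\<forall>e\<in>A. fuzzy_hypersubspace hop (pos (F e)) \<and>
      fuzzy_hypersubspace hop (\<lambda>x. - neg (F e) x))"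
proof -
  note nonempty = hypervector_space.hop_nonempty[OF assms]
  have INF: "c \<le> (INF t\<in>hop a x. f t) \<longleftrightarrow> (\<forall>t\<in>hop a x. c \<le> f t)"
    if "\<forall>x. f x \<in> {0..1}" for f :: "_ \<Rightarrow> real" and c a x
    using that by (intro le_cINF_iff nonempty bdd_belowI2[where m = 0]) auto
  have SUP: "(SUP t\<in>hop a x. f t) \<le> c \<longleftrightarrow> (\<forall>t\<in>hop a x. f t \<le> c)"
    if "\<forall>x. f x \<in> {-1..0}" for f :: "_ \<Rightarrow> real" and c a x
    using that by (intro cSUP_le_iff nonempty bdd_aboveI2[where M = 0]) auto
  have pos: "fuzzy_hypersubspace hop f \<longleftrightarrow> (\<forall>x. f x \<in> {0..1}) \<and>
      (\<forall>x y a. min (f x) (f y) \<le> f (x - y) \<and> f x \<le> (INF t\<in>hop a x. f t))" for f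
    unfolding fuzzy_hypersubspace_def using INF[of f] by (metis (no_types, lifting))
  have neg: "fuzzy_hypersubspace hop (\<lambda>x. - f x) \<longleftrightarrow> (\<forall>x. f x \<in> {-1..0}) \<and>
      (\<forall>x y a. f (x - y) \<le> max (f x) (f y) \<and> (SUP t\<in>hop a x. f t) \<le> f x)" for f
  proof -
    have "- f x \<in> {0..1} \<longleftrightarrow> f x \<in> {-1..0}" for x by auto
    moreover have "min (- f x) (- f y) \<le> - f (x - y) \<longleftrightarrow> f (x - y) \<le> max (f x) (f y)" for x y
      by linarith
    moreover have "- f x \<le> - f t \<longleftrightarrow> f t \<le> f x" for x t by simp
    ultimately show ?thesis
      unfolding fuzzy_hypersubspace_def using SUP[of f] by (metis (no_types, lifting))
  qed
  show ?thesis
    \<comment> \<open>The order matters: \<open>pos\<close> would also rewrite the instances with a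
      negated function, which \<open>neg\<close> must treat first.\<close>
    unfolding neg unfolding pos bipolar_fuzzy_soft_hypervector_space_def bipolar_fuzzy_soft_set_def
      prod.case by blast
qed

lemma sum_decompositions_eq: "{(y, z). x = y + z} = range (\<lambda>y::'v::ab_group_add. (y, x - y))"
  by (auto simp: image_iff)

lemma pos_bipolar_fuzzy_sum: "pos (bipolar_fuzzy_sum f g) = fuzzy_sum (pos f) (pos g)"
  by (simp add: fun_eq_iff bipolar_fuzzy_sum_def fuzzy_sum_def sum_decompositions_eq image_image)

text \<open>A real infimum is the negative of the supremum of the negatives, and negation turns
  \<open>max\<close> into \<open>min\<close>.\<close>

lemma uminus_neg_bipolar_fuzzy_sum:
  "(\<lambda>x. - neg (bipolar_fuzzy_sum f g) x) = fuzzy_sum (\<lambda>x. - neg f x) (\<lambda>x. - neg g x)"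
  by (simp add: fun_eq_iff bipolar_fuzzy_sum_def fuzzy_sum_def sum_decompositions_eq image_image
      Inf_real_def minus_max_eq_min)

theorem corollary4p9:
  fixes hop :: "'k::field \<Rightarrow> 'v::ab_group_add \<Rightarrow> 'v set"
    and F G :: "'e \<Rightarrow> 'v bipolar_fuzzy_set"
    and A B E :: "'e set"
  assumes "hypervector_space hop"
    and "bipolar_fuzzy_soft_hypervector_space hop E (F, A)"
    and "bipolar_fuzzy_soft_hypervector_space hop E (G, B)"
  shows "bipolar_fuzzy_soft_hypervector_space hop E (extended_sum (F, A) (G, B))"
  \<comment> \<open>On \<open>A \<inter> B\<close> the sum lemma applies to both signs; elsewhere in
    \<open>A \<union> B\<close> the conditions are inherited from \<open>F\<close> or
    \<open>G\<close>, and the \<open>undefined\<close> branch is never reached.\<close>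
  using assms(2,3) fuzzy_hypersubspace_fuzzy_sum[OF assms(1)]
  unfolding extended_sum_def prod.case bipolar_fuzzy_soft_hypervector_space_iff[OF assms(1)]
  by (auto simp: pos_bipolar_fuzzy_sum uminus_neg_bipolar_fuzzy_sum)

end
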